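(* Let $G$ be an unweighted graph with $n=|V(G)|\ge 2$ and let $k\ge 1$ be an integer. Then $k<\bar{s}(G)$ if and only if there exists no polynomial $$p\in s\left(I(G)*C(1,\dots,k)_{n}*S[x]\right)$$ such that all coefficients $\mathrm{coef}_j(p)$, $j\in\{0,\dots,n-1\}$, are pairwise different.
   Context: Graphs are finite and simple. For an edge labeling $\ell\colon E(G)\to\{1,\dots,k\}$ (not necessarily injective) the weighted degree of a vertex $v$ is the sum of the labels of the edges incident to $v$; $\ell$ is irregular if the weighted degrees of all vertices are pairwise different. The irregularity strength $\bar{s}(G)$ is the smallest $k\ge1$ for which an irregular labeling $E(G)\to\{1,\dots,k\}$ exists ($\bar{s}(G)=\infty$ if there is none). For a commutative ring $R$, an $R$-weighted complete graph $G$ is a complete graph on a finite vertex set $V(G)$ with a weight function $\nu_G$ from the set of all 2-element subsets of $V(G)$ to $R$. Weights in a subring are regarded as weights in the larger ring; here everything may be taken over $\mathbb{R}[x]$. If $H,G$ are $R$-weighted complete graphs with $|V(H)|=|V(G)|$ and $f\colon V(H)\to V(G)$ is a bijection, $H*_fG$ is the $R$-weighted complete graph on $V(H)$ with $\nu_{H*_fG}(e)=\nu_H(e)\cdot\nu_G(f(e))$, where $f(\{a,b\})=\{f(a),f(b)\}$. Put $H*G=\{H*_fG : f\colon V(H)\to V(G)\text{ a bijection}\}$, and for sets $\mathscr{H},\mathscr{G}$ of $R$-weighted complete graphs of the same order $\mathscr{H}*\mathscr{G}=\bigcup_{H\in\mathscr{H},\,G\in\mathscr{G}}H*G$. A single graph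 is identified with the corresponding singleton. The operation $*$ on sets is associative. For an $R$-weighted complete graph $G$, $s(G)=\sum_e\nu_G(e)$ (sum over all 2-element subsets $e$ of $V(G)$), and $s(\mathscr{G})=\{s(G):G\in\mathscr{G}\}$. Weighted complete graphs on the same vertex set are added and multiplied by scalars edgewise; for sets, $\mathscr{H}_1+\mathscr{H}_2=\{H_1+H_2: H_1\in\mathscr{H}_1,H_2\in\mathscr{H}_2\}$. For an unweighted graph $G$, $I(G)$ is the weighted complete graph on $V(G)$ with weight $1$ on edges of $G$ and $0$ on non-edges. For $j\in\{1,\dots,n\}$, $S(j)$ is the star with center $j$ on the vertex set $\{1,\dots,n\}$, and $S[x]=\sum_{j=1}^{n}x^{j-1}\cdot I(S(j))$. For a set $\mathscr{G}$ of weighted complete graphs of order $n$, $\mathscr{G}^{*m}$ is the $m$-fold product $\mathscr{G}*\cdots*\mathscr{G}$; if there is $m_0$ with $\mathscr{G}^{*m}=\mathscr{G}^{*m_0}$ for all $m\ge m_0$, then $\mathscr{G}^{*\infty}=\mathscr{G}^{*m_0}$; and $G^{*\infty}=\{G\}^{*\infty}$. Let $K_n$ be the complete graph on $\{1,\dots,n\}$ and $K_n\setminus e$ the graph $K_n$ with one (arbitrary fixed) edge $e$ removed. For $k\ge1$, $$C(1,\dots,k)_n=\sum_{i=1}^{k-1}\left(I(K_n\setminus e)^{*\infty}\cup\{I(K_n)\}\right)+I(K_n),$$ a sum of sets in the sense $\mathscr{H}_1+\mathscr{H}_2=\{H_1+H_2: H_1\in\mathscr{H}_1,H_2\in\mathscr{H}_2\}$,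 with $H_1+H_2$ the edgewise sum (for $k=1$ it is $\{I(K_n)\}$). $\mathrm{coef}_j(p)$ is the coefficient of $x^j$ in $p$. *)

theory Defs
  imports
    Complex_Main
    "HOL-Library.Extended_Nat"
    "HOL-Library.Ramsey"
    "HOL-Computational_Algebra.Polynomial"
begin

definition simple_graph :: "'a set \<Rightarrow> 'a set set \<Rightarrow> bool" where
  "simple_graph V E \<longleftrightarrow> finite V \<and> E \<subseteq> nsets V 2"

definition weighted_degree :: "'a set set \<Rightarrow> ('a set \<Rightarrow> nat) \<Rightarrow> 'a \<Rightarrow> nat" where
  "weighted_degree E l v = (\<Sum>e\<in>{e\<in>E. v \<in> e}. l e)"

definition irregular_labeling ::
    "'a set \<Rightarrow> 'a set set \<Rightarrow> nat \<Rightarrow> ('a set \<Rightarrow> nat) \<Rightarrow> bool" where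
  "irregular_labeling V E k l \<longleftrightarrow>
     (\<forall>e\<in>E. l e \<in> {1..k}) \<and> inj_on (weighted_degree E l) V"

definition irregularity_strength :: "'a set \<Rightarrow> 'a set set \<Rightarrow> enat" where
  "irregularity_strength V E =
     (if \<exists>k\<ge>1. \<exists>l. irregular_labeling V E k l
      then enat (LEAST k. 1 \<le> k \<and> (\<exists>l. irregular_labeling V E k l))
      else \<infinity>)"

datatype ('a, 'r) wcgraph = WCGraph (wverts: "'a set") (wt: "'a set \<Rightarrow> 'r")

text \<open>
  A weighted complete graph only carries weights on the 2-element subsets of its vertex set.
  Every construction below goes through \<open>wcg\<close>, which sets the irrelevant values to 0, so that
  equality in HOL is equality of weighted complete graphs.
\<close>

definition wcg :: "'a set \<Rightarrow> ('a set \<Rightarrow> 'r) \<Rightarrow> ('a, 'r::comm_ring_1) wcgraph" where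
  "wcg V w = WCGraph V (\<lambda>e. if e \<in> nsets V 2 then w e else 0)"

definition wcg_of_graph :: "'a set \<Rightarrow> 'a set set \<Rightarrow> ('a, 'r::comm_ring_1) wcgraph" where
  "wcg_of_graph V E = wcg V (\<lambda>e. if e \<in> E then 1 else 0)"

definition wcg_mult ::
    "('a, 'r) wcgraph \<Rightarrow> ('a \<Rightarrow> 'b) \<Rightarrow> ('b, 'r) wcgraph \<Rightarrow> ('a, 'r::comm_ring_1) wcgraph" where
  "wcg_mult H f G = wcg (wverts H) (\<lambda>e. wt H e * wt G (f ` e))"

text \<open>On finite vertex sets, the bijection forces the two orders to agree.\<close>

definition wset_mult ::
    "('a, 'r) wcgraph set \<Rightarrow> ('b, 'r) wcgraph set \<Rightarrow> ('a, 'r::comm_ring_1) wcgraph set"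
    (infixl "\<star>" 70) where
  "\<H> \<star> \<G> =
     {wcg_mult H f G | H f G. H \<in> \<H> \<and> G \<in> \<G> \<and> bij_betw f (wverts H) (wverts G)}"

text \<open>The \<open>m\<close>-fold product, for \<open>m \<ge> 1\<close> only.\<close>

definition wset_power ::
    "('a, 'r) wcgraph set \<Rightarrow> nat \<Rightarrow> ('a, 'r::comm_ring_1) wcgraph set" where
  "wset_power \<G> m = ((\<lambda>\<X>. \<X> \<star> \<G>) ^^ (m - 1)) \<G>"

text \<open>Unspecified if the powers do not stabilize.\<close>

definition wset_power_inf ::
    "('a, 'r) wcgraph set \<Rightarrow> ('a, 'r::comm_ring_1) wcgraph set" where
  "wset_power_inf \<G> = (THE \<S>. \<exists>m\<^sub>0\<ge>1. \<forall>m\<ge>m\<^sub>0. wset_power \<G> m = \<S>)"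

definition total_weight :: "('a, 'r::comm_ring_1) wcgraph \<Rightarrow> 'r" where
  "total_weight G = (\<Sum>e\<in>nsets (wverts G) 2. wt G e)"

text \<open>The edgewise sums are meant for graphs on the same vertex set.\<close>

definition wcg_add ::
    "('a, 'r) wcgraph \<Rightarrow> ('a, 'r) wcgraph \<Rightarrow> ('a, 'r::comm_ring_1) wcgraph" where
  "wcg_add H\<^sub>1 H\<^sub>2 = wcg (wverts H\<^sub>1) (\<lambda>e. wt H\<^sub>1 e + wt H\<^sub>2 e)"

definition wcg_scale :: "'r \<Rightarrow> ('a, 'r) wcgraph \<Rightarrow> ('a, 'r::comm_ring_1) wcgraph" where
  "wcg_scale c G = wcg (wverts G) (\<lambda>e. c * wt G e)"

definition wcg_sum ::
    "'a set \<Rightarrow> ('i \<Rightarrow> ('a, 'r) wcgraph) \<Rightarrow> 'i set \<Rightarrow> ('a, 'r::comm_ring_1) wcgraph" where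
  "wcg_sum V F J = wcg V (\<lambda>e. \<Sum>j\<in>J. wt (F j) e)"

definition wset_add ::
    "('a, 'r) wcgraph set \<Rightarrow> ('a, 'r) wcgraph set \<Rightarrow> ('a, 'r::comm_ring_1) wcgraph set" where
  "wset_add \<H>\<^sub>1 \<H>\<^sub>2 = {wcg_add H\<^sub>1 H\<^sub>2 | H\<^sub>1 H\<^sub>2. H\<^sub>1 \<in> \<H>\<^sub>1 \<and> H\<^sub>2 \<in> \<H>\<^sub>2}"

text \<open>
  The sum of \<open>m\<close> copies of a set of graphs on \<open>V\<close>, with independent choices of the summands.
  The empty sum consists of the graph with all weights 0.
\<close>

primrec wset_nsum ::
    "'a set \<Rightarrow> nat \<Rightarrow> ('a, 'r) wcgraph set \<Rightarrow> ('a, 'r::comm_ring_1) wcgraph set" where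
  "wset_nsum V 0 \<G> = {wcg V (\<lambda>_. 0)}"
| "wset_nsum V (Suc m) \<G> = wset_add (wset_nsum V m \<G>) \<G>"

definition complete_wcg :: "nat \<Rightarrow> (nat, 'r::comm_ring_1) wcgraph" where
  "complete_wcg n = wcg_of_graph {1..n} (nsets {1..n} 2)"

definition complete_minus_edge_wcg :: "nat \<Rightarrow> nat set \<Rightarrow> (nat, 'r::comm_ring_1) wcgraph" where
  "complete_minus_edge_wcg n e = wcg_of_graph {1..n} (nsets {1..n} 2 - {e})"

text \<open>\<open>C(1,\<dots>,k)\<^sub>n\<close>, built from the edge \<open>e\<close> of \<open>K\<^sub>n\<close>.\<close>

definition label_wcgs :: "nat \<Rightarrow> nat set \<Rightarrow> nat \<Rightarrow> (nat, 'r::comm_ring_1) wcgraph set" where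
  "label_wcgs n e k =
     wset_add
       (wset_nsum {1..n} (k - 1)
          (wset_power_inf {complete_minus_edge_wcg n e} \<union> {complete_wcg n}))
       {complete_wcg n}"

definition star_edges :: "nat \<Rightarrow> nat \<Rightarrow> nat set set" where
  "star_edges n j = {{j, i} | i. i \<in> {1..n} - {j}}"

definition star_poly_wcg :: "nat \<Rightarrow> (nat, real poly) wcgraph" where
  "star_poly_wcg n =
     wcg_sum {1..n} (\<lambda>j. wcg_scale (monom 1 (j - 1)) (wcg_of_graph {1..n} (star_edges n j))) {1..n}"

end

theory Submission
  imports Defs
begin

text \<open>
  A product \<open>I(G) * C * S[x]\<close> is read off from two bijections. The first places a member \<open>C\<close> of
  \<open>C(1,\<dots>,k)\<^sub>n\<close> on the vertices of \<open>G\<close>, so that the edges of \<open>G\<close> receive labels in \<open>{1,\<dots>,k}\<close>; the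
  second numbers the vertices of \<open>G\<close>. As \<open>S[x]\<close> has weight \<open>x\<^sup>i\<^sup>-\<^sup>1 + x\<^sup>j\<^sup>-\<^sup>1\<close> on \<open>{i, j}\<close>, each edge
  contributes its label once for each end, and the coefficients of the total weight are the
  weighted degrees of the vertices (\<open>coeff_total_weight_product\<close>). Distinct coefficients thus mean
  that the labeling is irregular.

  What has to be settled is which labelings occur. Multiplying copies of \<open>K\<^sub>n \<setminus> e\<close> keeps \<open>e\<close>
  missing from the left factor and lets each further factor delete one edge at will, so the powers
  stabilize at the set of all \<open>K\<^sub>n \<setminus> F\<close> with \<open>e \<in> F\<close> (\<open>wset_power_inf_complete_minus_edge\<close>). Hence a
  summand of \<open>C(1,\<dots>,k)\<^sub>n\<close> that vanishes anywhere vanishes on \<open>e\<close>, and \<open>C(1,\<dots>,k)\<^sub>n\<close> consists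
  only of those labelings of \<open>K\<^sub>n\<close> by \<open>{1,\<dots>,k}\<close> whose minimum is attained at \<open>e\<close>
  (\<open>label_wcgs_eq\<close>). This is no loss, because the first bijection is free: a labeling of \<open>G\<close>,
  continued by \<open>k\<close> to the non-edges, can be transported so that a pair of least label goes to
  \<open>e\<close> (\<open>labeling_transported_to_label_wcgs\<close>).
\<close>

section \<open>Weighted complete graphs\<close>

lemma wverts_wcg [simp]: "wverts (wcg V w) = V"
  by (simp add: wcg_def)

lemma wt_wcg [simp]: "wt (wcg V w) d = (if d \<in> nsets V 2 then w d else 0)"
  by (simp add: wcg_def)

lemma wcg_cong: "(\<And>d. d \<in> nsets V 2 \<Longrightarrow> w d = w' d) \<Longrightarrow> wcg V w = wcg V w'"
  by (auto simp: wcg_def)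

lemma bij_betw_image_mem_nsets:
  "bij_betw f V W \<Longrightarrow> d \<in> nsets V m \<Longrightarrow> f ` d \<in> nsets W m"
  using bij_betw_nsets bij_betwE by blast

lemma wcg_mult_wcg:
  assumes "bij_betw f V W"
  shows "wcg_mult (wcg V u) f (wcg W w) = wcg V (\<lambda>d. u d * w (f ` d))"
  unfolding wcg_mult_def
  by (auto intro!: wcg_cong simp: bij_betw_image_mem_nsets[OF assms])

lemma wcg_add_wcg: "wcg_add (wcg V u) (wcg V w) = wcg V (\<lambda>d. u d + w d)"
  unfolding wcg_add_def by (auto intro!: wcg_cong)

lemma ex_bij_betw_image_eq:
  assumes "finite V" "finite W" "card V = card W"
    and "d \<subseteq> V" "e \<subseteq> W" "card d = card e"
  obtains f where "bij_betw f V W" "f ` d = e"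
proof -
  have fin: "finite d" "finite e"
    using assms finite_subset by auto
  obtain g where g: "bij_betw g d e"
    using finite_same_card_bij[OF fin assms(6)] by blast
  have "card (V - d) = card (W - e)"
    using assms fin by (simp add: card_Diff_subset)
  then obtain h where h: "bij_betw h (V - d) (W - e)"
    using finite_same_card_bij[of "V - d" "W - e"] assms by blast
  define f where "f x = (if x \<in> d then g x else h x)" for x
  have fd: "bij_betw f d e"
    using g by (simp add: f_def cong: bij_betw_cong)
  have "bij_betw f (V - d) (W - e)"
    using h by (subst bij_betw_cong[of _ _ h]) (auto simp: f_def)
  from bij_betw_combine[OF fd this] have "bij_betw f V W"
    using assms by (simp add: Un_absorb1)
  with fd show thesis
    using that bij_betw_imp_surj_on by blast
qed

lemma wset_mult_singleton_image:
  "{H} \<star> (g ` L) = {wcg_mult H f (g l) | f l. l \<in> L \<and> bij_betw f (wverts H) (wverts (g l))}"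
  unfolding wset_mult_def by blast

lemma wset_add_image:
  "wset_add (g ` A) (h ` B) = (\<lambda>(a, b). wcg_add (g a) (h b)) ` (A \<times> B)"
  unfolding wset_add_def by force

lemma wset_add_singleton: "wset_add \<H> {G} = (\<lambda>H. wcg_add H G) ` \<H>"
  unfolding wset_add_def by blast

section \<open>Powers of the complete graph without an edge\<close>

definition complete_minus :: "'a set \<Rightarrow> 'a set set \<Rightarrow> ('a, 'r::comm_ring_1) wcgraph" where
  "complete_minus V F = wcg V (\<lambda>d. if d \<in> F then 0 else 1)"

lemma complete_wcg_eq: "complete_wcg n = complete_minus {1..n} {}"
  unfolding complete_wcg_def wcg_of_graph_def complete_minus_def by (rule wcg_cong) simp

lemma complete_minus_edge_wcg_eq: "complete_minus_edge_wcg n e = complete_minus {1..n} {e}"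
  unfolding complete_minus_edge_wcg_def wcg_of_graph_def complete_minus_def
  by (rule wcg_cong) simp

text \<open>
  The right factor deletes the one edge that the chosen bijection sends to \<open>e\<close>. Permutations of
  the vertices act transitively on the edges, so this can be any edge.
\<close>

lemma wset_mult_complete_minus_edge:
  fixes \<F> :: "'a set set set"
  assumes "finite V" and e: "e \<in> nsets V 2"
  shows "(complete_minus V ` \<F>) \<star> {complete_minus V {e}} =
    (complete_minus V ` {insert d F | d F. d \<in> nsets V 2 \<and> F \<in> \<F>} :: ('a, 'r::comm_ring_1) wcgraph set)"
    (is "?L = ?R")
proof -
  have mult: "wcg_mult (complete_minus V F) f (complete_minus V {e}) =
      (complete_minus V (insert d F) :: ('a, 'r) wcgraph)"
    if f: "bij_betw f V V" and d: "d \<in> nsets V 2" "f ` d = e" for f d F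
  proof -
    have "f ` c = e \<longleftrightarrow> c = d" if "c \<in> nsets V 2" for c
      using bij_betw_nsets[OF f, of 2] that d by (metis bij_betw_imp_inj_on inj_onD)
    then show ?thesis
      unfolding complete_minus_def wcg_mult_wcg[OF f] by (intro wcg_cong) auto
  qed
  show ?thesis
  proof
    show "?L \<subseteq> ?R"
    proof
      fix X :: "('a, 'r) wcgraph"
      assume "X \<in> ?L"
      then obtain F f where F: "F \<in> \<F>" and f: "bij_betw f V V"
        and X: "X = wcg_mult (complete_minus V F) f (complete_minus V {e})"
        by (auto simp: wset_mult_def complete_minus_def)
      obtain d where d: "d \<in> nsets V 2" "f ` d = e"
        using bij_betw_imp_surj_on[OF bij_betw_nsets[OF f, of 2]] e by (metis imageE)
      have "insert d F \<in> {insert d F | d F. d \<in> nsets V 2 \<and> F \<in> \<F>}"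
        using d F by blast
      then show "X \<in> ?R"
        unfolding X mult[OF f d] by (rule imageI)
    qed
    show "?R \<subseteq> ?L"
    proof
      fix X :: "('a, 'r) wcgraph"
      assume "X \<in> ?R"
      then obtain d F where d: "d \<in> nsets V 2" and F: "F \<in> \<F>"
        and X: "X = complete_minus V (insert d F)"
        by auto
      have "d \<subseteq> V" "e \<subseteq> V" "card d = card e"
        using d e by (auto simp: nsets_def)
      then obtain f where f: "bij_betw f V V" "f ` d = e"
        using ex_bij_betw_image_eq[OF assms(1,1) refl] by metis
      have "X = wcg_mult (complete_minus V F) f (complete_minus V {e})"
        unfolding X using mult[OF f(1) d f(2)] by simp
      then show "X \<in> ?L"
        unfolding wset_mult_def using F f(1) by (force simp: complete_minus_def)
    qed
  qed
qed

text \<open>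
  The first factor deletes \<open>e\<close>, whatever the bijections are. Each further factor deletes one edge,
  possibly one that is missing already, which is why all smaller sets occur as well.
\<close>

lemma wset_power_complete_minus_edge:
  assumes "finite V" and e: "e \<in> nsets V 2"
  shows "wset_power {complete_minus V {e}} (Suc m) =
    (complete_minus V ` {F. e \<in> F \<and> F \<subseteq> nsets V 2 \<and> card F \<le> Suc m} ::
      ('a, 'r::comm_ring_1) wcgraph set)"
proof (induction m)
  case 0
  have "F = {e}" if F: "e \<in> F" "F \<subseteq> nsets V 2" "card F \<le> Suc 0" for F
  proof -
    have "finite F"
      using F(2) finite_imp_finite_nsets[OF assms(1)] by (rule finite_subset)
    then show ?thesis
      using F by (auto simp: card_le_Suc0_iff_eq)
  qed
  then have "{F. e \<in> F \<and> F \<subseteq> nsets V 2 \<and> card F \<le> Suc 0} = {{e}}"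
    using e by auto
  then show ?case
    by (simp add: wset_power_def)
next
  case (Suc m)
  let ?F = "\<lambda>m. {F. e \<in> F \<and> F \<subseteq> nsets V 2 \<and> card F \<le> m}"
  have fin: "finite F" if "F \<subseteq> nsets V 2" for F
    using finite_imp_finite_nsets[OF assms(1)] that by (rule finite_subset[rotated])
  have "{insert d F | d F. d \<in> nsets V 2 \<and> F \<in> ?F (Suc m)} = ?F (Suc (Suc m))" (is "?A = ?B")
  proof
    show "?A \<subseteq> ?B"
      by (auto simp: card_insert_if fin)
    show "?B \<subseteq> ?A"
    proof
      fix F assume F: "F \<in> ?B"
      show "F \<in> ?A"
      proof (cases "F = {e}")
        case True
        \<comment> \<open>The last factor deletes \<open>e\<close> once more.\<close>
        then have "F = insert e {e}" "{e} \<in> ?F (Suc m)"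
          using e by auto
        then show ?thesis
          using e by blast
      next
        case False
        then obtain d where d: "d \<in> F" "d \<noteq> e"
          using F by blast
        then have "F = insert d (F - {d})" "F - {d} \<in> ?F (Suc m)"
          using F fin[of F] by (auto simp: card_Diff_singleton_if)
        then show ?thesis
          using d F by blast
      qed
    qed
  qed
  moreover have "wset_power {complete_minus V {e}} (Suc (Suc m)) =
      wset_power {complete_minus V {e}} (Suc m) \<star> {complete_minus V {e} :: ('a, 'r) wcgraph}"
    by (simp add: wset_power_def)
  ultimately show ?case
    by (simp only: Suc.IH wset_mult_complete_minus_edge[OF assms])
qed

lemma wset_power_inf_eqI:
  assumes "\<And>m. m \<ge> m\<^sub>0 \<Longrightarrow> wset_power \<G> m = \<S>"
  shows "wset_power_inf \<G> = \<S>"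
  unfolding wset_power_inf_def
proof (rule the_equality)
  show "\<exists>m\<^sub>0\<ge>1. \<forall>m\<ge>m\<^sub>0. wset_power \<G> m = \<S>"
    using assms by (intro exI[of _ "max 1 m\<^sub>0"]) auto
next
  fix \<T> assume "\<exists>m\<^sub>1\<ge>1. \<forall>m\<ge>m\<^sub>1. wset_power \<G> m = \<T>"
  then obtain m\<^sub>1 where "\<forall>m\<ge>m\<^sub>1. wset_power \<G> m = \<T>"
    by blast
  then show "\<T> = \<S>"
    using assms[of "max m\<^sub>0 m\<^sub>1"] by (metis max.cobounded1 max.cobounded2)
qed

lemma wset_power_inf_complete_minus_edge:
  assumes "finite V" and e: "e \<in> nsets V 2"
  shows "wset_power_inf {complete_minus V {e}} =
    (complete_minus V ` {F. e \<in> F \<and> F \<subseteq> nsets V 2} :: ('a, 'r::comm_ring_1) wcgraph set)"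
proof (rule wset_power_inf_eqI)
  fix m assume m: "m \<ge> Suc (card (nsets V 2))"
  then obtain m' where m': "m = Suc m'"
    using Suc_le_D by blast
  have "card F \<le> m" if "F \<subseteq> nsets V 2" for F
    using card_mono[OF finite_imp_finite_nsets[OF assms(1)] that] m by simp
  then have "{F. e \<in> F \<and> F \<subseteq> nsets V 2 \<and> card F \<le> m} = {F. e \<in> F \<and> F \<subseteq> nsets V 2}"
    by blast
  then show "wset_power {complete_minus V {e}} m =
      (complete_minus V ` {F. e \<in> F \<and> F \<subseteq> nsets V 2} :: ('a, 'r) wcgraph set)"
    using wset_power_complete_minus_edge[OF assms, of m'] by (simp only: m')
qed

section \<open>The labelings of the complete graph in \<open>C(1,\<dots>,k)\<^sub>n\<close>\<close>

text \<open>
  A labeling whose minimum is attained at \<open>e\<close> is peeled off one layer at a time: the layer is zero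
  where the labeling is, so if it is zero anywhere, it is zero at \<open>e\<close>; and lowering all positive
  labels by one keeps the minimum at \<open>e\<close>.
\<close>

lemma wset_nsum_complete_minus:
  assumes "e \<in> nsets V 2"
  shows "wset_nsum V m (complete_minus V ` {F. F \<subseteq> nsets V 2 \<and> (F \<noteq> {} \<longrightarrow> e \<in> F)}) =
    ((\<lambda>l. wcg V (\<lambda>d. of_nat (l d))) ` {l. \<forall>d \<in> nsets V 2. l e \<le> l d \<and> l d \<le> m} ::
      ('a, 'r::comm_ring_1) wcgraph set)"
proof (induction m)
  case 0
  have zero: "wcg V (\<lambda>d. of_nat (l d)) = (wcg V (\<lambda>_. 0) :: ('a, 'r) wcgraph)"
    if "\<forall>d \<in> nsets V 2. l e \<le> l d \<and> l d \<le> 0" for l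
    using that by (intro wcg_cong) auto
  have "(\<lambda>l. wcg V (\<lambda>d. of_nat (l d))) ` {l. \<forall>d \<in> nsets V 2. l e \<le> l d \<and> l d \<le> 0} =
      (\<lambda>_. wcg V (\<lambda>_. 0) :: ('a, 'r) wcgraph) ` {l. \<forall>d \<in> nsets V 2. l e \<le> l d \<and> l d \<le> (0::nat)}"
    by (intro image_cong refl zero) (simp only: mem_Collect_eq)
  also have "\<dots> = {wcg V (\<lambda>_. 0)}"
    by (intro image_constant[of "\<lambda>_. 0"]) simp
  finally show ?case
    by simp
next
  case (Suc m)
  let ?\<F> = "{F. F \<subseteq> nsets V 2 \<and> (F \<noteq> {} \<longrightarrow> e \<in> F)}"
  let ?L = "\<lambda>m. {l. \<forall>d \<in> nsets V 2. l e \<le> l d \<and> l d \<le> (m::nat)}"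
  have sum: "wcg_add (wcg V (\<lambda>d. of_nat (l d))) (complete_minus V F) =
      (wcg V (\<lambda>d. of_nat (l d + (if d \<in> F then 0 else 1))) :: ('a, 'r) wcgraph)" for l F
    unfolding complete_minus_def wcg_add_wcg by (rule wcg_cong) auto
  have "wset_nsum V (Suc m) (complete_minus V ` ?\<F>) =
      ((\<lambda>(l, F). wcg V (\<lambda>d. of_nat (l d + (if d \<in> F then 0 else 1)))) ` (?L m \<times> ?\<F>) ::
        ('a, 'r) wcgraph set)"
    by (simp only: wset_nsum.simps Suc.IH wset_add_image sum)
  also have "\<dots> = (\<lambda>l. wcg V (\<lambda>d. of_nat (l d))) ` ?L (Suc m)" (is "?A = ?B")
  proof
    show "?A \<subseteq> ?B"
    proof
      fix X assume "X \<in> ?A"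
      then obtain l F where l: "l \<in> ?L m" and F: "F \<in> ?\<F>"
        and X: "X = wcg V (\<lambda>d. of_nat (l d + (if d \<in> F then 0 else 1)))"
        by auto
      have "(\<lambda>d. l d + (if d \<in> F then 0 else 1)) \<in> ?L (Suc m)"
        using l F by (auto intro: le_SucI)
      then show "X \<in> ?B"
        unfolding X by (rule imageI[where f = "\<lambda>l. wcg V (\<lambda>d. of_nat (l d))"])
    qed
    show "?B \<subseteq> ?A"
    proof
      fix X assume "X \<in> ?B"
      then obtain l where l: "l \<in> ?L (Suc m)" and X: "X = wcg V (\<lambda>d. of_nat (l d))"
        by blast
      let ?l = "\<lambda>d. l d - 1" and ?F = "{d \<in> nsets V 2. l d = 0}"
      have "?l \<in> ?L m"
        using l by (auto simp: diff_le_mono)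
      moreover have "?F \<in> ?\<F>"
        using l assms by auto
      moreover have "X = wcg V (\<lambda>d. of_nat (?l d + (if d \<in> ?F then 0 else 1)))"
        unfolding X by (rule wcg_cong) auto
      ultimately show "X \<in> ?A"
        by (intro image_eqI[of _ _ "(?l, ?F)"]) auto
    qed
  qed
  finally show ?case .
qed

lemma label_wcgs_eq:
  assumes e: "e \<in> nsets {1..n} 2" and "k \<ge> 1"
  shows "label_wcgs n e k =
    ((\<lambda>l. wcg {1..n} (\<lambda>d. of_nat (l d))) ` {l. \<forall>d \<in> nsets {1..n} 2. l e \<le> l d \<and> l d \<in> {1..k}} ::
      (nat, 'r::comm_ring_1) wcgraph set)"
proof -
  let ?N = "nsets {1..n} 2"
  let ?L = "{l. \<forall>d \<in> ?N. l e \<le> l d \<and> l d \<le> k - 1}"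
  have summands: "wset_power_inf {complete_minus_edge_wcg n e} \<union> {complete_wcg n} =
      (complete_minus {1..n} ` {F. F \<subseteq> ?N \<and> (F \<noteq> {} \<longrightarrow> e \<in> F)} :: (nat, 'r) wcgraph set)"
  proof -
    have "{F. F \<subseteq> ?N \<and> (F \<noteq> {} \<longrightarrow> e \<in> F)} = insert {} {F. e \<in> F \<and> F \<subseteq> ?N}"
      by blast
    then show ?thesis
      using wset_power_inf_complete_minus_edge[OF finite_atLeastAtMost e, where 'r = 'r]
      by (simp add: complete_minus_edge_wcg_eq complete_wcg_eq)
  qed
  have sum: "wcg_add (wcg {1..n} (\<lambda>d. of_nat (l d))) (complete_minus {1..n} {}) =
      (wcg {1..n} (\<lambda>d. of_nat (Suc (l d))) :: (nat, 'r) wcgraph)" for l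
    unfolding complete_minus_def wcg_add_wcg by (rule wcg_cong) auto
  have "label_wcgs n e k =
      ((\<lambda>l. wcg {1..n} (\<lambda>d. of_nat (Suc (l d)))) ` ?L :: (nat, 'r) wcgraph set)"
    unfolding label_wcgs_def summands
    unfolding wset_nsum_complete_minus[OF e] complete_wcg_eq wset_add_singleton image_image sum ..
  also have "\<dots> = (\<lambda>l. wcg {1..n} (\<lambda>d. of_nat (l d))) ` {l. \<forall>d \<in> ?N. l e \<le> l d \<and> l d \<in> {1..k}}"
    (is "_ = ?B")
  proof (intro equalityI subsetI; elim imageE)
    fix X :: "(nat, 'r) wcgraph" and l
    assume "l \<in> ?L" "X = wcg {1..n} (\<lambda>d. of_nat (Suc (l d)))"
    then show "X \<in> ?B"
      using assms by (intro image_eqI[of _ _ "\<lambda>d. Suc (l d)"]) fastforce+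
  next
    fix X :: "(nat, 'r) wcgraph" and l
    assume l: "l \<in> {l. \<forall>d \<in> ?N. l e \<le> l d \<and> l d \<in> {1..k}}"
      and X: "X = wcg {1..n} (\<lambda>d. of_nat (l d))"
    have "X = wcg {1..n} (\<lambda>d. of_nat (Suc (l d - 1)))"
      unfolding X using l by (intro wcg_cong) auto
    moreover have "(\<lambda>d. l d - 1) \<in> ?L"
      using l by (auto simp: diff_le_mono)
    ultimately show "X \<in> (\<lambda>l. wcg {1..n} (\<lambda>d. of_nat (Suc (l d)))) ` ?L"
      by (intro image_eqI[of _ _ "\<lambda>d. l d - 1"])
  qed
  finally show ?thesis .
qed

text \<open>
  The pairs outside \<open>E\<close> need some label too. They get the largest one, \<open>k\<close>, so that the
  extension has the same minimum as \<open>l\<close>, or is constant if there are no edges. A pair of least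
  label is the one to send to \<open>e\<close>.
\<close>

lemma labeling_transported_to_label_wcgs:
  fixes l :: "'a set \<Rightarrow> nat"
  assumes "finite V" "card V = n" and e: "e \<in> nsets {1..n} 2" and "k \<ge> 1"
    and l: "\<And>d. d \<in> E \<Longrightarrow> l d \<in> {1..k}" and "E \<subseteq> nsets V 2"
  obtains f l' where "bij_betw f V {1..n}"
    and "\<forall>d \<in> nsets {1..n} 2. l' e \<le> l' d \<and> l' d \<in> {1..k}"
    and "\<forall>d \<in> E. l' (f ` d) = l d"
proof -
  define L where "L d = (if d \<in> E then l d else k)" for d
  have L: "L d \<in> {1..k}" for d
    using l \<open>k \<ge> 1\<close> by (auto simp: L_def)
  have "card (nsets V 2) = card (nsets {1..n} 2)"
    using assms by (simp add: card_nsets)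
  then have "nsets V 2 \<noteq> {}"
    using e finite_imp_finite_nsets[of "{1..n}" 2] by (metis card.empty card_0_eq empty_iff finite_atLeastAtMost)
  then obtain d\<^sub>0 where d\<^sub>0: "d\<^sub>0 \<in> nsets V 2" "\<And>d. d \<in> nsets V 2 \<Longrightarrow> L d\<^sub>0 \<le> L d"
    using finite_imp_finite_nsets[OF \<open>finite V\<close>, of 2] by (metis arg_min_if_finite(1) arg_min_least)
  have "d\<^sub>0 \<subseteq> V" "e \<subseteq> {1..n}" "card d\<^sub>0 = card e"
    using d\<^sub>0(1) e by (auto simp: nsets_def)
  then obtain f where f: "bij_betw f V {1..n}" "f ` d\<^sub>0 = e"
    using ex_bij_betw_image_eq[OF \<open>finite V\<close>, of "{1..n}"] assms(2)
    by (metis card_atLeastAtMost diff_Suc_1 finite_atLeastAtMost)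
  have bij: "bij_betw ((`) f) (nsets V 2) (nsets {1..n} 2)"
    using bij_betw_nsets[OF f(1)] .
  define l' where "l' d = L (inv_into (nsets V 2) ((`) f) d)" for d
  have l'_image: "l' (f ` d) = L d" if "d \<in> nsets V 2" for d
    using bij_betw_inv_into_left[OF bij that] by (simp add: l'_def)
  show thesis
  proof (rule that[OF f(1)]; intro ballI)
    fix d assume "d \<in> nsets {1..n} 2"
    then obtain c where "c \<in> nsets V 2" "d = f ` c"
      using bij by (metis bij_betw_imp_surj_on imageE)
    then show "l' e \<le> l' d \<and> l' d \<in> {1..k}"
      using l'_image d\<^sub>0 f(2) L by metis
  next
    fix d assume "d \<in> E"
    then show "l' (f ` d) = l d"
      using l'_image[of d] assms(6) by (auto simp: L_def)
  qed
qed

section \<open>Coefficients and weighted degrees\<close>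

lemma coeff_wt_star_poly_wcg:
  assumes d: "d \<in> nsets {1..n} 2"
  shows "coeff (wt (star_poly_wcg n) d) j = of_bool (Suc j \<in> d)"
proof -
  have sub: "d \<subseteq> {1..n}"
    using d by (auto simp: nsets_def)
  have mem: "d \<in> star_edges n i \<longleftrightarrow> i \<in> d" if "i \<in> {1..n}" for i
  proof
    assume "d \<in> star_edges n i"
    then show "i \<in> d"
      by (auto simp: star_edges_def)
  next
    assume i: "i \<in> d"
    obtain a b where ab: "d = {a, b}" "a \<noteq> b"
      using d by (auto simp: nsets_def card_2_iff)
    obtain i' where "d = {i, i'}" "i' \<noteq> i"
      using i ab by (cases "i = a") (auto simp: insert_commute)
    then show "d \<in> star_edges n i"
      using sub by (auto simp: star_edges_def)
  qed
  have "coeff (wt (star_poly_wcg n) d) j =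
      (\<Sum>i\<in>{1..n}. coeff (monom 1 (i - 1) * (if d \<in> star_edges n i then 1 else 0)) j)"
    using d by (simp add: star_poly_wcg_def wcg_sum_def wcg_scale_def wcg_of_graph_def coeff_sum)
  also have "\<dots> = (\<Sum>i\<in>{1..n}. if i = Suc j then of_bool (Suc j \<in> d) else 0)"
    by (rule sum.cong) (auto simp: mem)
  also have "\<dots> = of_bool (Suc j \<in> d)"
    using sub by (auto simp: sum.delta)
  finally show ?thesis .
qed

text \<open>
  Vertex \<open>v\<close> is numbered \<open>g v\<close>, and the star at \<open>g v\<close> carries the power of \<open>x\<close> with exponent
  \<open>g v - 1\<close>. The coefficient of this power therefore collects the labels of exactly the edges at \<open>v\<close>.
\<close>

lemma coeff_total_weight_product:
  fixes l :: "nat set \<Rightarrow> nat"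
  assumes "simple_graph V E" and f: "bij_betw f V {1..n}" and g: "bij_betw g V {1..n}"
    and v: "v \<in> V" "g v = Suc j"
  shows "coeff (total_weight (wcg_mult (wcg_mult (wcg_of_graph V E) f (wcg {1..n} (\<lambda>d. of_nat (l d))))
      g (star_poly_wcg n))) j = of_nat (weighted_degree E (\<lambda>d. l (f ` d)) v)"
proof -
  have E: "E \<subseteq> nsets V 2" and fin: "finite (nsets V 2)"
    using assms(1) by (auto simp: simple_graph_def finite_imp_finite_nsets)
  have incident: "Suc j \<in> g ` d \<longleftrightarrow> v \<in> d" if "d \<in> nsets V 2" for d
    using inj_on_image_mem_iff[OF bij_betw_imp_inj_on[OF g] v(1), of d] that v(2)
    by (auto simp: nsets_def)
  have summand: "coeff ((if d \<in> E then 1 else 0) * of_nat (l (f ` d)) * wt (star_poly_wcg n) (g ` d)) j =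
      (if d \<in> {d \<in> E. v \<in> d} then of_nat (l (f ` d)) else 0)" if "d \<in> nsets V 2" for d
    using coeff_wt_star_poly_wcg[OF bij_betw_image_mem_nsets[OF g that], of j] incident[OF that]
    by (simp add: of_nat_poly)
  have "coeff (total_weight (wcg_mult (wcg_mult (wcg_of_graph V E) f (wcg {1..n} (\<lambda>d. of_nat (l d))))
      g (star_poly_wcg n))) j =
      (\<Sum>d\<in>nsets V 2. coeff ((if d \<in> E then 1 else 0) * of_nat (l (f ` d)) * wt (star_poly_wcg n) (g ` d)) j)"
    unfolding total_weight_def wcg_of_graph_def wcg_mult_wcg[OF f] wcg_mult_def[of _ g]
    by (simp add: coeff_sum)
  also have "\<dots> = (\<Sum>d\<in>nsets V 2. if d \<in> {d \<in> E. v \<in> d} then of_nat (l (f ` d)) else 0)"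
    by (rule sum.cong) (use summand in auto)
  also have "\<dots> = (\<Sum>d\<in>{d \<in> E. v \<in> d}. of_nat (l (f ` d)))"
    using E by (intro sum.mono_neutral_cong_right) (auto simp: fin)
  finally show ?thesis
    by (simp add: weighted_degree_def)
qed

lemma inj_on_coeff_total_weight_product:
  fixes l :: "nat set \<Rightarrow> nat"
  assumes "simple_graph V E" and f: "bij_betw f V {1..n}" and g: "bij_betw g V {1..n}" and "n \<ge> 1"
  shows "inj_on (coeff (total_weight (wcg_mult (wcg_mult (wcg_of_graph V E) f
      (wcg {1..n} (\<lambda>d. of_nat (l d)))) g (star_poly_wcg n)))) {0..n - 1} \<longleftrightarrow>
    inj_on (weighted_degree E (\<lambda>d. l (f ` d))) V" (is "inj_on (coeff ?p) _ \<longleftrightarrow> inj_on ?w V")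
proof -
  let ?h = "\<lambda>v. g v - 1"
  have "bij_betw (\<lambda>i. i - 1) {1..n} {0..n - 1}"
    using \<open>n \<ge> 1\<close> by (intro bij_betw_byWitness[where f' = Suc]) auto
  from bij_betw_trans[OF g this] have h: "bij_betw ?h V {0..n - 1}"
    by (simp add: comp_def)
  have "coeff ?p (?h v) = of_nat (?w v)" if "v \<in> V" for v
    using that bij_betwE[OF g] by (intro coeff_total_weight_product[OF assms(1) f g]) auto
  then have "inj_on (coeff ?p \<circ> ?h) V \<longleftrightarrow> inj_on ?w V"
    by (auto simp: inj_on_def)
  moreover have "inj_on (coeff ?p \<circ> ?h) V \<longleftrightarrow> inj_on (coeff ?p) {0..n - 1}"
    using h by (metis bij_betw_def comp_inj_on_iff)
  ultimately show ?thesis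
    by simp
qed

section \<open>Irregularity strength\<close>

text \<open>
  A labeling by \<open>{1,\<dots>,k}\<close> is also one by any longer range, so the numbers \<open>k\<close> admitting an irregular
  labeling are closed upwards and one value of \<open>k\<close> decides on which side of the minimum it lies.
\<close>

lemma less_irregularity_strength_iff:
  assumes "k \<ge> 1"
  shows "enat k < irregularity_strength V E \<longleftrightarrow> \<not> (\<exists>l. irregular_labeling V E k l)"
proof -
  let ?P = "\<lambda>k. 1 \<le> k \<and> (\<exists>l. irregular_labeling V E k l)"
  have mono: "?P k'" if "?P k" "k \<le> k'" for k k'
    using that by (fastforce simp: irregular_labeling_def)
  show ?thesis
  proof (cases "\<exists>k. ?P k")
    case True
    then have "?P (LEAST k. ?P k)"
      by (rule LeastI_ex)
    then have "k < (LEAST k. ?P k) \<longleftrightarrow> \<not> ?P k"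
      using mono[of "LEAST k. ?P k" k] not_less_Least[of k ?P] by fastforce
    then show ?thesis
      using True assms by (auto simp: irregularity_strength_def)
  next
    case False
    then show ?thesis
      using assms by (auto simp: irregularity_strength_def)
  qed
qed

theorem theorem2p8:
  fixes V :: "'a set" and E :: "'a set set" and n k :: nat and e :: "nat set"
  assumes "simple_graph V E"
    and "n = card V" and "n \<ge> 2"
    and "k \<ge> 1"
    and "e \<in> nsets {1..n} 2"
  shows "enat k < irregularity_strength V E \<longleftrightarrow>
    \<not> (\<exists>p \<in> total_weight ` ({wcg_of_graph V E} \<star> label_wcgs n e k \<star> {star_poly_wcg n}).
          inj_on (coeff p) {0..n - 1})"
proof -
  have V: "finite V" and E: "E \<subseteq> nsets V 2"
    using assms(1) by (auto simp: simple_graph_def)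
  let ?prod = "\<lambda>f l g. wcg_mult (wcg_mult (wcg_of_graph V E) f (wcg {1..n} (\<lambda>d. of_nat (l d))))
    g (star_poly_wcg n)"
  let ?minimal = "\<lambda>l. \<forall>d \<in> nsets {1..n} 2. l e \<le> l d \<and> l d \<in> {1..k}"
  have verts: "wverts (wcg_of_graph V E :: ('a, real poly) wcgraph) = V" "wverts (star_poly_wcg n) = {1..n}"
    "wverts (wcg_mult H f G) = wverts H"
    for H :: "('a, real poly) wcgraph" and f and G :: "(nat, real poly) wcgraph"
    by (simp_all add: wcg_of_graph_def star_poly_wcg_def wcg_sum_def wcg_mult_def)
  have prods: "{wcg_of_graph V E} \<star> label_wcgs n e k \<star> {star_poly_wcg n} =
      {?prod f l g | f l g. ?minimal l \<and> bij_betw f V {1..n} \<and> bij_betw g V {1..n}}"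
  proof -
    have "{wcg_of_graph V E :: ('a, real poly) wcgraph} \<star> label_wcgs n e k =
        {wcg_mult (wcg_of_graph V E) f (wcg {1..n} (\<lambda>d. of_nat (l d))) | f l.
          ?minimal l \<and> bij_betw f V {1..n}}" (is "_ = ?X")
      unfolding label_wcgs_eq[OF assms(5,4)] wset_mult_singleton_image
      by (simp only: verts wverts_wcg mem_Collect_eq)
    moreover have "?X \<star> {star_poly_wcg n} =
        {?prod f l g | f l g. (?minimal l \<and> bij_betw f V {1..n}) \<and>
          bij_betw g (wverts (wcg_mult (wcg_of_graph V E) f
            (wcg {1..n} (\<lambda>d. of_nat (l d) :: real poly)))) (wverts (star_poly_wcg n))}"
      unfolding wset_mult_def by blast
    ultimately show ?thesis
      by (simp only: verts conj_assoc)
  qed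
  have coeffs: "inj_on (coeff (total_weight (?prod f l g))) {0..n - 1} \<longleftrightarrow>
      inj_on (weighted_degree E (\<lambda>d. l (f ` d))) V"
    if "bij_betw f V {1..n}" "bij_betw g V {1..n}" for f l g
    using inj_on_coeff_total_weight_product[OF assms(1) that] assms(3) by simp
  have "(\<exists>p \<in> total_weight ` ({wcg_of_graph V E} \<star> label_wcgs n e k \<star> {star_poly_wcg n}).
      inj_on (coeff p) {0..n - 1}) \<longleftrightarrow>
    (\<exists>f l g. ?minimal l \<and> bij_betw f V {1..n} \<and> bij_betw g V {1..n} \<and>
      inj_on (coeff (total_weight (?prod f l g))) {0..n - 1})"
    unfolding prods by blast
  also have "\<dots> \<longleftrightarrow> (\<exists>f l. ?minimal l \<and> bij_betw f V {1..n} \<and>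
      inj_on (weighted_degree E (\<lambda>d. l (f ` d))) V)"
    by (simp only: coeffs cong: conj_cong) blast
  also have "\<dots> \<longleftrightarrow> (\<exists>l. irregular_labeling V E k l)"
  proof
    assume "\<exists>f l. ?minimal l \<and> bij_betw f V {1..n} \<and> inj_on (weighted_degree E (\<lambda>d. l (f ` d))) V"
    then obtain f l where "?minimal l" and f: "bij_betw f V {1..n}"
      and "inj_on (weighted_degree E (\<lambda>d. l (f ` d))) V"
      by blast
    then have "irregular_labeling V E k (\<lambda>d. l (f ` d))"
      using bij_betw_image_mem_nsets[OF f] E unfolding irregular_labeling_def by blast
    then show "\<exists>l. irregular_labeling V E k l"
      by (rule exI[of _ "\<lambda>d. l (f ` d)"])
  next
    assume "\<exists>l. irregular_labeling V E k l"
    then obtain l where l: "\<And>d. d \<in> E \<Longrightarrow> l d \<in> {1..k}" "inj_on (weighted_degree E l) V"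
      by (auto simp: irregular_labeling_def)
    obtain f l' where f: "bij_betw f V {1..n}"
      and l': "?minimal l'" "\<forall>d \<in> E. l' (f ` d) = l d"
      by (rule labeling_transported_to_label_wcgs[OF V assms(2)[symmetric] assms(5,4) l(1) E]) blast
    have "weighted_degree E (\<lambda>d. l' (f ` d)) = weighted_degree E l"
      by (auto simp: weighted_degree_def l'(2) intro!: sum.cong)
    then have "inj_on (weighted_degree E (\<lambda>d. l' (f ` d))) V"
      using l(2) by (simp only:)
    with f l'(1) show "\<exists>f l. ?minimal l \<and> bij_betw f V {1..n} \<and>
        inj_on (weighted_degree E (\<lambda>d. l (f ` d))) V"
      by (intro exI[of _ f] exI[of _ l']) blast
  qed
  finally show ?thesis
    using less_irregularity_strength_iff[OF assms(4)] by blast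
qed

end
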